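(* Let $T\in\mathcal{PC}_{n-1}$ be inconsistent with constant row sums, and let $a>0$. Then the Perron vector of the matrix $$A=\begin{bmatrix} T & a\mathbf{e}_{n-1}\\ \frac1a\mathbf{e}_{n-1}^T & 1\end{bmatrix}\in\mathcal{PC}_n$$ is inefficient for $A$.
   Context: $n\ge 2$. $\mathcal{PC}_n$ denotes the set of $n\times n$ reciprocal matrices, i.e. real matrices $A=[a_{ij}]$ with all entries positive and $a_{ji}=1/a_{ij}$ for all $i,j$ (so $a_{ii}=1$). A reciprocal matrix $A$ is consistent if $a_{ij}a_{jk}=a_{ik}$ for all $i,j,k$, and inconsistent otherwise. $\mathbf{e}_{m}$ is the column $m$-vector with all entries $1$. The Perron vector of a positive square matrix is any entrywise positive (right) eigenvector (unique up to positive scalar multiple). A positive vector $w$ is efficient for $A\in\mathcal{PC}_n$ if, for every positive $n$-vector $v$, the inequalities $|a_{ij}-v_i/v_j|\le|a_{ij}-w_i/w_j|$ for all $i,j$ imply that $v$ is a positive scalar multiple of $w$; otherwise $w$ is inefficient for $A$. *)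

theory Defs
  imports "Jordan_Normal_Form.Char_Poly"
begin

text \<open>Matrix and vector indices run over \<open>{0..<n}\<close>.\<close>

definition reciprocal_matrices :: "nat \<Rightarrow> real mat set" where
  "reciprocal_matrices n =
     {A \<in> carrier_mat n n. \<forall>i<n. \<forall>j<n. A $$ (i,j) > 0 \<and> A $$ (j,i) = 1 / A $$ (i,j)}"

definition consistent :: "real mat \<Rightarrow> bool" where
  "consistent A \<longleftrightarrow>
     (\<forall>i<dim_row A. \<forall>j<dim_row A. \<forall>k<dim_row A.
        A $$ (i,j) * A $$ (j,k) = A $$ (i,k))"

definition constant_row_sums :: "real mat \<Rightarrow> bool" where
  "constant_row_sums A \<longleftrightarrow> (\<exists>r. \<forall>i<dim_row A. (\<Sum>j<dim_col A. A $$ (i,j)) = r)"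

definition positive_vec :: "real vec \<Rightarrow> bool" where
  "positive_vec v \<longleftrightarrow> (\<forall>i<dim_vec v. v $ i > 0)"

definition perron_vector :: "real mat \<Rightarrow> real vec \<Rightarrow> bool" where
  "perron_vector A w \<longleftrightarrow> positive_vec w \<and> (\<exists>k. eigenvector A w k)"

definition efficient :: "real mat \<Rightarrow> real vec \<Rightarrow> bool" where
  "efficient A w \<longleftrightarrow>
     w \<in> carrier_vec (dim_row A) \<and> positive_vec w \<and>
     (\<forall>v \<in> carrier_vec (dim_row A). positive_vec v \<longrightarrow>
        (\<forall>i<dim_row A. \<forall>j<dim_row A.
           \<bar>A $$ (i,j) - v $ i / v $ j\<bar> \<le> \<bar>A $$ (i,j) - w $ i / w $ j\<bar>) \<longrightarrow>
        (\<exists>c>0. v = c \<cdot>\<^sub>v w))"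

definition inefficient :: "real mat \<Rightarrow> real vec \<Rightarrow> bool" where
  "inefficient A w \<longleftrightarrow>
     w \<in> carrier_vec (dim_row A) \<and> positive_vec w \<and> \<not> efficient A w"

definition ones_col :: "nat \<Rightarrow> real mat" where
  "ones_col m = mat m 1 (\<lambda>_. 1)"

definition bordered_matrix :: "real mat \<Rightarrow> real \<Rightarrow> real mat" where
  "bordered_matrix T a =
     four_block_mat
       T                                                (a \<cdot>\<^sub>m ones_col (dim_row T))
       ((1 / a) \<cdot>\<^sub>m transpose_mat (ones_col (dim_row T))) (1\<^sub>m 1)"

end

theory Submission imports Defs begin

text \<open>
  Write \<open>m = n - 1\<close> and let \<open>r\<close> be the common row sum of \<open>T\<close>. Comparing the largest and the
  smallest of the first \<open>m\<close> entries of a positive eigenvector \<open>w\<close> shows that these entries are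
  equal, so \<open>w = (x, \<dots>, x, y)\<close> and the eigenvalue equations reduce to \<open>(k - r) x = a y\<close> and
  \<open>(k - 1) a y = m x\<close>; hence \<open>(k - r) (k - 1) = m\<close>.

  Inconsistency enters through the row sum: since \<open>t + 1/t \<ge> 2\<close> with equality only at \<open>t = 1\<close>,
  an inconsistent reciprocal matrix has \<open>r > m\<close> (lemma \<open>inconsistent_row_sum_gt\<close>). Then
  \<open>k - r \<ge> 1\<close> would give \<open>(k - r) (k - 1) \<ge> r > m\<close>, so \<open>k - r < 1\<close>, which means \<open>x / y > a\<close>
  (lemma \<open>perron_vector_bordered\<close>).

  Replacing \<open>y\<close> by \<open>x / a\<close> therefore changes the vector up to scaling. It leaves all ratios
  inside the \<open>T\<close> block untouched and makes the ratios in the last row and column exact, so it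
  shows that \<open>w\<close> is inefficient.
\<close>

lemma add_inverse_ge_2:
  fixes t :: real
  assumes "t > 0"
  shows "t + 1 / t \<ge> 2" and "t + 1 / t \<le> 2 \<Longrightarrow> t = 1"
proof -
  have eq: "t + 1 / t - 2 = (t - 1)\<^sup>2 / t"
    using assms by (simp add: field_simps power2_eq_square)
  have "(t - 1)\<^sup>2 / t \<ge> 0"
    using assms by simp
  with eq show "t + 1 / t \<ge> 2"
    by linarith
  show "t = 1" if "t + 1 / t \<le> 2"
  proof -
    from eq \<open>(t - 1)\<^sup>2 / t \<ge> 0\<close> that have "(t - 1)\<^sup>2 / t = 0"
      by linarith
    with assms show ?thesis by simp
  qed
qed

text \<open>The sum of all entries is \<open>m r\<close>. Pairing each entry with its transposed one bounds twice
  this sum below by \<open>2 m\<^sup>2\<close>, and equality forces every entry to be \<open>1\<close>.\<close>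

lemma inconsistent_row_sum_gt:
  assumes T: "T \<in> reciprocal_matrices m"
    and inc: "\<not> consistent T"
    and r: "\<And>i. i < m \<Longrightarrow> (\<Sum>j<m. T $$ (i,j)) = r"
  shows "r > real m"
proof (rule ccontr)
  assume "\<not> r > real m"
  then have le: "r \<le> real m" by simp
  have pos: "T $$ (i,j) > 0" and rec: "T $$ (j,i) = 1 / T $$ (i,j)"
    if "i < m" "j < m" for i j
    using T that unfolding reciprocal_matrices_def by blast+
  define g where "g i j = T $$ (i,j) + T $$ (j,i) - 2" for i j
  have g_nonneg: "g i j \<ge> 0" if "i < m" "j < m" for i j
    unfolding g_def using add_inverse_ge_2(1)[OF pos[OF that]] rec[OF that] by simp
  have "(\<Sum>i<m. \<Sum>j<m. T $$ (i,j)) = real m * r"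
    using r by simp
  moreover have "(\<Sum>i<m. \<Sum>j<m. T $$ (j,i)) = (\<Sum>i<m. \<Sum>j<m. T $$ (i,j))"
    by (rule sum.swap)
  ultimately have "(\<Sum>i<m. \<Sum>j<m. g i j) = 2 * (real m * r) - 2 * (real m * real m)"
    unfolding g_def by (simp add: sum.distrib sum_subtractf)
  also have "\<dots> \<le> 0"
    using mult_left_mono[OF le, of "real m"] by simp
  finally have "(\<Sum>i<m. \<Sum>j<m. g i j) \<le> 0" .
  then have "(\<Sum>i<m. \<Sum>j<m. g i j) = 0"
    using g_nonneg by (intro antisym sum_nonneg) auto
  then have rows: "(\<Sum>j<m. g i j) = 0" if "i < m" for i
    using that g_nonneg by (subst (asm) sum_nonneg_eq_0_iff) (auto intro: sum_nonneg)
  have g0: "g i j = 0" if "i < m" "j < m" for i j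
    using rows[OF that(1)] that g_nonneg by (subst (asm) sum_nonneg_eq_0_iff) auto
  have one: "T $$ (i,j) = 1" if "i < m" "j < m" for i j
    using add_inverse_ge_2(2)[OF pos[OF that]] g0[OF that] rec[OF that] by (simp add: g_def)
  have "dim_row T = m"
    using T unfolding reciprocal_matrices_def by auto
  with one inc show False
    unfolding consistent_def by auto
qed

lemma bordered_matrix_carrier:
  assumes "T \<in> carrier_mat m m"
  shows "bordered_matrix T a \<in> carrier_mat (Suc m) (Suc m)"
  using assms unfolding bordered_matrix_def ones_col_def by auto

lemma bordered_matrix_index:
  assumes "T \<in> carrier_mat m m" and "i \<le> m" and "j \<le> m"
  shows "bordered_matrix T a $$ (i,j) =
    (if i < m then if j < m then T $$ (i,j) else a
     else if j < m then 1 / a else 1)"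
  using assms unfolding bordered_matrix_def ones_col_def by auto

lemma bordered_matrix_reciprocal:
  assumes "T \<in> reciprocal_matrices m" and "a > 0"
  shows "bordered_matrix T a \<in> reciprocal_matrices (Suc m)"
proof -
  have T: "T \<in> carrier_mat m m"
    using assms(1) unfolding reciprocal_matrices_def by auto
  let ?B = "bordered_matrix T a"
  have "?B $$ (i,j) > 0 \<and> ?B $$ (j,i) = 1 / ?B $$ (i,j)" if "i < Suc m" "j < Suc m" for i j
  proof (cases "i < m \<and> j < m")
    case True
    then have "T $$ (i,j) > 0 \<and> T $$ (j,i) = 1 / T $$ (i,j)"
      using assms(1) unfolding reciprocal_matrices_def by blast
    with True show ?thesis
      by (simp only: bordered_matrix_index[OF T] less_imp_le if_True)
  next
    case False
    with that \<open>a > 0\<close> show ?thesis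
      by (auto simp: bordered_matrix_index[OF T] less_Suc_eq_le)
  qed
  then show ?thesis
    using bordered_matrix_carrier[OF T] unfolding reciprocal_matrices_def by blast
qed

text \<open>Working with an arbitrary positive eigenvector avoids the Perron-Frobenius theorem: at a
  maximal entry the eigenvalue equation gives \<open>(k - r) max \<le> a y\<close>, at a minimal one
  \<open>a y \<le> (k - r) min\<close>, where \<open>y\<close> is the last entry. Since \<open>a y > 0\<close>, the second inequality
  gives \<open>k > r\<close>, and the two together give \<open>max = min\<close>.\<close>

lemma perron_vector_bordered:
  assumes T: "T \<in> reciprocal_matrices m"
    and inc: "\<not> consistent T"
    and r: "\<And>i. i < m \<Longrightarrow> (\<Sum>j<m. T $$ (i,j)) = r"
    and a: "a > 0"
    and w: "perron_vector (bordered_matrix T a) w"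
  obtains x where "x > 0" and "\<And>i. i < m \<Longrightarrow> w $ i = x" and "x / w $ m > a"
proof -
  define A where "A = bordered_matrix T a"
  have Tc: "T \<in> carrier_mat m m"
    using T unfolding reciprocal_matrices_def by auto
  have Ac: "A \<in> carrier_mat (Suc m) (Suc m)"
    unfolding A_def by (rule bordered_matrix_carrier[OF Tc])
  note A_index = bordered_matrix_index[OF Tc, of _ _ a, folded A_def]
  have T_pos: "T $$ (i,j) > 0" if "i < m" "j < m" for i j
    using T that unfolding reciprocal_matrices_def by blast
  have "m > 0"
    using inc Tc unfolding consistent_def by auto
  obtain k where pos: "positive_vec w" and eig: "eigenvector A w k"
    using w unfolding perron_vector_def A_def by auto
  have wc: "w \<in> carrier_vec (Suc m)" and Aw: "A *\<^sub>v w = k \<cdot>\<^sub>v w"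
    using eig Ac unfolding eigenvector_def by auto
  have w_pos: "w $ i > 0" if "i \<le> m" for i
    using pos that wc unfolding positive_vec_def by auto
  have sum_eq: "(\<Sum>j<Suc m. A $$ (i,j) * w $ j) = k * w $ i" if "i \<le> m" for i
  proof -
    have "(A *\<^sub>v w) $ i = (\<Sum>j<Suc m. A $$ (i,j) * w $ j)"
      using Ac wc that
      by (auto simp: scalar_prod_def less_Suc_eq_le atLeast0LessThan intro!: sum.cong)
    moreover have "(k \<cdot>\<^sub>v w) $ i = k * w $ i"
      using wc that by auto
    ultimately show ?thesis using Aw by simp
  qed
  have row: "(\<Sum>j<m. T $$ (i,j) * w $ j) + a * w $ m = k * w $ i" if "i < m" for i
    using sum_eq[of i] that by (simp add: A_index)
  have last: "(\<Sum>j<m. w $ j / a) + w $ m = k * w $ m"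
    using sum_eq[of m] by (simp add: A_index)
  define W where "W = (\<lambda>i. w $ i) ` {..<m}"
  have W: "finite W" "W \<noteq> {}"
    using \<open>m > 0\<close> unfolding W_def by auto
  obtain p where p: "p < m" "w $ p = Max W"
    using Max_in[OF W] unfolding W_def by auto
  obtain q where q: "q < m" "w $ q = Min W"
    using Min_in[OF W] unfolding W_def by auto
  have bounds: "w $ q \<le> w $ j" "w $ j \<le> w $ p" if "j < m" for j
    using that W p q unfolding W_def by auto
  have "(\<Sum>j<m. T $$ (p,j) * w $ j) \<le> (\<Sum>j<m. T $$ (p,j) * w $ p)"
    using bounds T_pos p by (intro sum_mono mult_left_mono) (auto simp: less_imp_le)
  also have "\<dots> = r * w $ p"
    using r[OF p(1)] by (simp flip: sum_distrib_right)
  finally have upper: "(k - r) * w $ p \<le> a * w $ m"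
    using row[OF p(1)] by (simp add: algebra_simps)
  have "r * w $ q = (\<Sum>j<m. T $$ (q,j) * w $ q)"
    using r[OF q(1)] by (simp flip: sum_distrib_right)
  also have "\<dots> \<le> (\<Sum>j<m. T $$ (q,j) * w $ j)"
    using bounds T_pos q by (intro sum_mono mult_left_mono) (auto simp: less_imp_le)
  finally have lower: "a * w $ m \<le> (k - r) * w $ q"
    using row[OF q(1)] by (simp add: algebra_simps)
  have "0 < a * w $ m"
    using a w_pos by simp
  with lower have "0 < (k - r) * w $ q" by linarith
  then have kr: "k - r > 0"
    using w_pos[of q] q by (simp add: zero_less_mult_iff)
  from upper lower have "(k - r) * w $ p \<le> (k - r) * w $ q" by linarith
  with kr have pq: "w $ p \<le> w $ q" by simp
  define x where "x = w $ p"
  have const: "w $ i = x" if "i < m" for i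
    using bounds[OF that] pq unfolding x_def by linarith
  have x: "x > 0"
    using w_pos[of p] p(1) unfolding x_def by simp
  have eq1: "(k - r) * x = a * w $ m"
    using upper lower const[OF q(1)] const[OF p(1)] by simp
  have eq2: "(k - 1) * (a * w $ m) = real m * x"
    using last a const by (simp add: field_simps)
  have "real m * x = (k - 1) * ((k - r) * x)"
    using eq1 eq2 by simp
  then have prod: "(k - 1) * (k - r) = real m"
    using x by simp
  have rm: "r > real m"
    using inconsistent_row_sum_gt[OF T inc r] .
  have "k - r < 1"
  proof (rule ccontr)
    assume "\<not> k - r < 1"
    then have "1 \<le> k - r" by simp
    with rm have "real m < k - 1" "0 \<le> k - 1" by linarith+
    note \<open>real m < k - 1\<close>
    also have "k - 1 \<le> (k - 1) * (k - r)"
      using mult_left_mono[OF \<open>1 \<le> k - r\<close> \<open>0 \<le> k - 1\<close>] by simp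
    finally have "real m < (k - 1) * (k - r)" .
    with prod show False by simp
  qed
  with x have "(k - r) * x < x" by simp
  with eq1 have "a < x / w $ m"
    using w_pos[of m] by (simp add: field_simps)
  with x const show thesis by (intro that)
qed

theorem mainTheorem9:
  fixes n :: nat and T :: "real mat" and a :: real
  assumes "n \<ge> 2"
    and "T \<in> reciprocal_matrices (n - 1)"
    and "\<not> consistent T"
    and "constant_row_sums T"
    and "a > 0"
  shows "bordered_matrix T a \<in> reciprocal_matrices n \<and>
         (\<forall>w. perron_vector (bordered_matrix T a) w \<longrightarrow> inefficient (bordered_matrix T a) w)"
proof (intro conjI allI impI)
  define m where "m = n - 1"
  have n: "n = Suc m" and T: "T \<in> reciprocal_matrices m"
    using assms(1,2) unfolding m_def by auto
  show "bordered_matrix T a \<in> reciprocal_matrices n"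
    unfolding n by (rule bordered_matrix_reciprocal[OF T \<open>a > 0\<close>])
  fix w
  assume w: "perron_vector (bordered_matrix T a) w"
  have Tc: "T \<in> carrier_mat m m"
    using T unfolding reciprocal_matrices_def by auto
  note dim = bordered_matrix_carrier[OF Tc, of a, THEN carrier_matD(1)]
  obtain r where "\<And>i. i < m \<Longrightarrow> (\<Sum>j<m. T $$ (i,j)) = r"
    using assms(4) Tc unfolding constant_row_sums_def by (auto simp: atLeast0LessThan)
  then obtain x where x: "x > 0" "\<And>i. i < m \<Longrightarrow> w $ i = x" "x / w $ m > a"
    using perron_vector_bordered[OF T assms(3) _ \<open>a > 0\<close> w] by metis
  have pos: "positive_vec w" and wc: "w \<in> carrier_vec (Suc m)"
    using w dim unfolding perron_vector_def eigenvector_def by auto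
  have y: "w $ m > 0"
    using pos wc unfolding positive_vec_def by auto
  \<comment> \<open>The last entry is raised to the value at which all ratios with the others
    equal the border entries \<open>a\<close> and \<open>1 / a\<close> exactly.\<close>
  define v where "v = vec (Suc m) (\<lambda>i. if i < m then x else x / a)"
  have v_pos: "positive_vec v"
    using x \<open>a > 0\<close> unfolding v_def positive_vec_def by auto
  have closer: "\<bar>bordered_matrix T a $$ (i,j) - v $ i / v $ j\<bar>
      \<le> \<bar>bordered_matrix T a $$ (i,j) - w $ i / w $ j\<bar>" if "i \<le> m" "j \<le> m" for i j
    using that x y \<open>a > 0\<close> by (auto simp: bordered_matrix_index[OF Tc] v_def)
  have "m > 0"
    using assms(1) unfolding m_def by simp
  have "\<not> (\<exists>c>0. v = c \<cdot>\<^sub>v w)"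
  proof
    assume "\<exists>c>0. v = c \<cdot>\<^sub>v w"
    then obtain c where c: "v = c \<cdot>\<^sub>v w" by auto
    have "v $ 0 = c * w $ 0" "v $ m = c * w $ m"
      using wc unfolding c by auto
    then have "x = c * x" and m: "x / a = c * w $ m"
      using \<open>m > 0\<close> x(2) by (auto simp: v_def)
    then have "x / a = w $ m"
      using x(1) by simp
    with x(3) y \<open>a > 0\<close> show False
      by (simp add: field_simps)
  qed
  moreover have "v \<in> carrier_vec (Suc m)"
    unfolding v_def by simp
  ultimately have "\<not> efficient (bordered_matrix T a) w"
    using closer v_pos unfolding efficient_def dim less_Suc_eq_le by blast
  then show "inefficient (bordered_matrix T a) w"
    using pos wc dim unfolding inefficient_def by simp
qed

end
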